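(* Let $\mathfrak g=\mathfrak{sl}_2$ and let $\mathcal A_{t,w_0}$ be the quantum cluster algebra of type $A_1$ with quantum cluster variables $\underline Q_{\omega,q^r}$ and $\underline Q_{s(\omega),q^r}$ ($r\in 2\mathbb Z$) defined in the context. For all $r\in 2\mathbb Z$ the following equations hold: $$\underline{Q}_{\omega,q^{r-2}}\,\underline{Q}_{s(\omega),q^r}-t^{-1}\,\underline{Q}_{\omega,q^{r}}\,\underline{Q}_{s(\omega),q^{r-2}}=1,$$ $$\underline{Q}_{s(\omega),q^r}\,\underline{Q}_{\omega,q^{r-2}}-t\,\underline{Q}_{\omega,q^{r}}\,\underline{Q}_{s(\omega),q^{r-2}}=1.$$
   Context: Here $\omega$ is the fundamental weight and $s$ the simple reflection of $\mathfrak{sl}_2$; the symbols $\underline Q_{\omega,q^r},\underline Q_{s(\omega),q^r}$ are names of quantum cluster variables, defined as follows. Initial quantum seed. The vertex set is $2\mathbb Z$. The quiver $\Gamma_c$ has arrows $r\to r+2$ for all $r\in2\mathbb Z$, $r\ne -2$, and the arrow $0\to -2$ (instead of $-2\to 0$). Its exchange matrix $B_c$ is $b_{v,w}=\#\{v\to w\}-\#\{w\to v\}$. Let $f:\mathbb Z\to\mathbb Z$ be the odd function with $f(m)=\frac{(-1)^m-1}{2}$ for $m\ge0$, let $(\Lambda_e)_{r,r'}=f\big(\tfrac{r'-r}{2}\big)$, let $\varepsilon_r=1$ for $r\ge 0$ and $\varepsilon_r=-1$ for $r\le -2$, and let $(\Lambda_c)_{r,r'}=\varepsilon_r\varepsilon_{r'}(\Lambda_e)_{r,r'}$.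 The pair $(\Lambda_c,B_c)$ is compatible. $\mathcal A_{t,w_0}$ is the associated quantum cluster algebra over $\mathbb Z[t^{\pm\frac12}]$ (Berenstein–Zelevinsky conventions), inside the quantum torus generated by the invertible initial variables $X_r$, $r\in 2\mathbb Z$, with $X_rX_{r'}=t^{(\Lambda_c)_{r,r'}}X_{r'}X_r$. For a quantum seed with matrices $(\Lambda,B)$ and toric frame $M$ (so $M(e_v)$ is the cluster variable at $v$ and $M(a)M(b)=t^{\Lambda(a,b)/2}M(a+b)$), mutation at $k$ replaces $M(e_k)$ by $M\big(-e_k+\sum_{b_{w,k}>0}b_{w,k}e_w\big)+M\big(-e_k-\sum_{b_{w,k}<0}b_{w,k}e_w\big)$. The variables. Let $S_0$ be the initial quantum seed. For $k\in\mathbb Z$, let the seeds $S_k$ be defined by the rule that $S_{k+1}$ and $S_k$ are related by mutation at the vertex $-2k-2$. The quiver of $S_k$ is the translate of $\Gamma_c$ by $-2k$. The cluster variable of $S_k$ at vertex $r$ is denoted $\underline Q_{\omega,q^r}$ if $r\ge -2k$, and $\underline Q_{s(\omega),q^{r+2}}$ if $r\le -2k-2$; this is independent of $k$. In particular $X_r=\underline Q_{\omega,q^r}$ for $r\ge0$ and $X_r=\underline Q_{s(\omega),q^{r+2}}$ for $r\le-2$. *)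

theory Defs
  imports "HOL-Library.Poly_Mapping"
begin

text \<open>
  Quantum seeds and their mutation follow the conventions of Berenstein and Zelevinsky.
  A lattice vector \<open>a\<close> in the free abelian group on the vertices is a finitely supported function
  of type \<open>'v \<Rightarrow>\<^sub>0 int\<close>; the basis vector \<open>e\<^sub>v\<close> is \<open>Poly_Mapping.single v 1\<close>.  Throughout, \<open>h\<close>
  stands for the scalar \<open>t\<^sup>1\<^sup>/\<^sup>2\<close>, so that \<open>h powi n\<close> is \<open>t\<^sup>n\<^sup>/\<^sup>2\<close>.
\<close>

definition lam_ext :: "('v \<Rightarrow> 'v \<Rightarrow> int) \<Rightarrow> ('v \<Rightarrow>\<^sub>0 int) \<Rightarrow> ('v \<Rightarrow>\<^sub>0 int) \<Rightarrow> int" where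
  "lam_ext L a b =
     (\<Sum>v\<in>Poly_Mapping.keys a. \<Sum>w\<in>Poly_Mapping.keys b.
        Poly_Mapping.lookup a v * Poly_Mapping.lookup b w * L v w)"

record ('v, 'f) qseed =
  cvar :: "'v \<Rightarrow> 'f"
  lam :: "'v \<Rightarrow> 'v \<Rightarrow> int"
  exch :: "'v \<Rightarrow> 'v \<Rightarrow> int"

text \<open>
  The toric frame of a quantum seed, recovered from its cluster variables \<open>x\<^sub>v\<close>:
  \<open>M(a) = t^(-1/2 \<Sum>\<^bsub>v<w\<^esub> a\<^sub>v a\<^sub>w \<Lambda>\<^bsub>vw\<^esub>) \<Prod>\<^sub>v x\<^sub>v^a\<^sub>v\<close>, the product being taken in increasing order
  of the vertices.  For \<open>t^\<Lambda>\<close>-commuting variables this is the normalisation for which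
  \<open>M(a) M(b) = t^(\<Lambda>(a,b)/2) M(a + b)\<close>, and it does not depend on the order of the vertices.
\<close>

definition frame :: "'f::division_ring \<Rightarrow> ('v::linorder, 'f) qseed \<Rightarrow> ('v \<Rightarrow>\<^sub>0 int) \<Rightarrow> 'f" where
  "frame h S a =
     h powi (- (\<Sum>v\<in>Poly_Mapping.keys a. \<Sum>w\<in>{w \<in> Poly_Mapping.keys a. v < w}.
                  Poly_Mapping.lookup a v * Poly_Mapping.lookup a w * lam S v w))
     * prod_list (map (\<lambda>v. cvar S v powi Poly_Mapping.lookup a v)
                      (sorted_list_of_set (Poly_Mapping.keys a)))"

text \<open>
  The two exponents in the exchange relation at \<open>k\<close>.  The sums range over the neighbours of \<open>k\<close>
  in the quiver, a finite set for the locally finite quivers considered here.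
\<close>

definition exch_pos :: "('v, 'f) qseed \<Rightarrow> 'v \<Rightarrow> 'v \<Rightarrow>\<^sub>0 int" where
  "exch_pos S k = - Poly_Mapping.single k 1
     + (\<Sum>w | exch S w k > 0. Poly_Mapping.single w (exch S w k))"

definition exch_neg :: "('v, 'f) qseed \<Rightarrow> 'v \<Rightarrow> 'v \<Rightarrow>\<^sub>0 int" where
  "exch_neg S k = - Poly_Mapping.single k 1
     - (\<Sum>w | exch S w k < 0. Poly_Mapping.single w (exch S w k))"

definition exch_basis :: "('v, 'f) qseed \<Rightarrow> 'v \<Rightarrow> 'v \<Rightarrow> 'v \<Rightarrow>\<^sub>0 int" where
  "exch_basis S k v = (if v = k then exch_pos S k else Poly_Mapping.single v 1)"

text \<open>
  The quasi-commutation matrix is transformed by the base change replacing \<open>e\<^sub>k\<close> by \<open>exch_pos S k\<close>;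
  for a compatible pair, \<open>exch_neg S k\<close> gives the same matrix.
\<close>

definition mutate ::
  "'f::division_ring \<Rightarrow> 'v::linorder \<Rightarrow> ('v, 'f) qseed \<Rightarrow> ('v, 'f) qseed" where
  "mutate h k S = \<lparr>
     cvar = (cvar S)(k := frame h S (exch_pos S k) + frame h S (exch_neg S k)),
     lam = (\<lambda>v w. lam_ext (lam S) (exch_basis S k v) (exch_basis S k w)),
     exch = (\<lambda>v w. if v = k \<or> w = k then - exch S v w
             else exch S v w
                  + (\<bar>exch S v k\<bar> * exch S k w + exch S v k * \<bar>exch S k w\<bar>) div 2)\<rparr>"

inductive_set mutation_class ::
  "'f::division_ring \<Rightarrow> 'v::linorder set \<Rightarrow> ('v, 'f) qseed \<Rightarrow> ('v, 'f) qseed set"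
  for h V S\<^sub>0 where
  initial: "S\<^sub>0 \<in> mutation_class h V S\<^sub>0"
| mutation: "S \<in> mutation_class h V S\<^sub>0 \<Longrightarrow> k \<in> V \<Longrightarrow> mutate h k S \<in> mutation_class h V S\<^sub>0"

inductive_set quantum_cluster_algebra ::
  "'f::division_ring \<Rightarrow> 'v::linorder set \<Rightarrow> ('v, 'f) qseed \<Rightarrow> 'f set"
  for h V S\<^sub>0 where
  cluster_variable:
    "S \<in> mutation_class h V S\<^sub>0 \<Longrightarrow> v \<in> V \<Longrightarrow> cvar S v \<in> quantum_cluster_algebra h V S\<^sub>0"
| scalar: "h powi n \<in> quantum_cluster_algebra h V S\<^sub>0"
| diff: "x \<in> quantum_cluster_algebra h V S\<^sub>0 \<Longrightarrow> y \<in> quantum_cluster_algebra h V S\<^sub>0 \<Longrightarrow>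
    x - y \<in> quantum_cluster_algebra h V S\<^sub>0"
| mult: "x \<in> quantum_cluster_algebra h V S\<^sub>0 \<Longrightarrow> y \<in> quantum_cluster_algebra h V S\<^sub>0 \<Longrightarrow>
    x * y \<in> quantum_cluster_algebra h V S\<^sub>0"

text \<open>The vertices are the even integers; odd integers are isolated in \<open>arrow_c\<close> and never used.\<close>

definition vertices :: "int set" where
  "vertices = {r. even r}"

definition arrow_c :: "int \<Rightarrow> int \<Rightarrow> bool" where
  "arrow_c v w \<longleftrightarrow> v \<in> vertices \<and> w \<in> vertices \<and>
     (v \<noteq> -2 \<and> w = v + 2 \<or> v = 0 \<and> w = -2)"

definition B_c :: "int \<Rightarrow> int \<Rightarrow> int" where
  "B_c v w = of_bool (arrow_c v w) - of_bool (arrow_c w v)"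

definition f_odd :: "int \<Rightarrow> int" where
  "f_odd m = (if m \<ge> 0 then ((-1) ^ nat m - 1) div 2 else - (((-1) ^ nat (- m) - 1) div 2))"

definition Lam_e :: "int \<Rightarrow> int \<Rightarrow> int" where
  "Lam_e r r' = f_odd ((r' - r) div 2)"

definition eps :: "int \<Rightarrow> int" where
  "eps r = (if r \<ge> 0 then 1 else -1)"

definition Lam_c :: "int \<Rightarrow> int \<Rightarrow> int" where
  "Lam_c r r' = eps r * eps r' * Lam_e r r'"

text \<open>
  The group of normalised monomials \<open>t\<^sup>n\<^sup>/\<^sup>2 X\<^sup>a\<close> with \<open>n \<in> \<int>\<close> and \<open>a\<close> a finitely supported integer vector
  on \<open>vertices\<close>, whose law is \<open>t\<^sup>n\<^sup>/\<^sup>2 X\<^sup>a \<cdot> t\<^sup>m\<^sup>/\<^sup>2 X\<^sup>b = t^((n + m + \<Lambda>\<^sub>c(a,b))/2) X\<^sup>a\<^sup>+\<^sup>b\<close>.  The law is written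
  additively, although it is not commutative, because the convolution product of
  \<open>Poly_Mapping\<close> expects its exponents in \<open>monoid_add\<close>.
\<close>

typedef tmonom =
  "{(n :: int, a :: int \<Rightarrow>\<^sub>0 int). Poly_Mapping.keys a \<subseteq> vertices}"
  morphisms rep_tmonom tmonom
  by (rule exI[of _ "(0, 0)"]) simp

setup_lifting type_definition_tmonom

lemma lam_ext_superset:
  assumes "finite A" "Poly_Mapping.keys a \<subseteq> A" "finite B" "Poly_Mapping.keys b \<subseteq> B"
  shows "lam_ext L a b =
    (\<Sum>v\<in>A. \<Sum>w\<in>B. Poly_Mapping.lookup a v * Poly_Mapping.lookup b w * L v w)"
proof -
  have "lam_ext L a b =
      (\<Sum>v\<in>Poly_Mapping.keys a. \<Sum>w\<in>B. Poly_Mapping.lookup a v * Poly_Mapping.lookup b w * L v w)"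
    unfolding lam_ext_def
    by (intro sum.cong refl sum.mono_neutral_left) (use assms in \<open>auto simp: in_keys_iff\<close>)
  also have "\<dots> = (\<Sum>v\<in>A. \<Sum>w\<in>B. Poly_Mapping.lookup a v * Poly_Mapping.lookup b w * L v w)"
    by (intro sum.mono_neutral_left) (use assms in \<open>auto simp: in_keys_iff\<close>)
  finally show ?thesis .
qed

lemma lam_ext_add_left: "lam_ext L (a + b) c = lam_ext L a c + lam_ext L b c"
proof -
  let ?A = "Poly_Mapping.keys a \<union> Poly_Mapping.keys b" and ?C = "Poly_Mapping.keys c"
  have *: "finite ?A" "finite ?C" "Poly_Mapping.keys (a + b) \<subseteq> ?A"
    using Poly_Mapping.keys_add[of a b] by auto
  show ?thesis
    using * by (simp add: lam_ext_superset[of ?A _ ?C] lookup_add algebra_simps sum.distrib)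
qed

lemma lam_ext_add_right: "lam_ext L a (b + c) = lam_ext L a b + lam_ext L a c"
proof -
  let ?A = "Poly_Mapping.keys a" and ?C = "Poly_Mapping.keys b \<union> Poly_Mapping.keys c"
  have *: "finite ?A" "finite ?C" "Poly_Mapping.keys (b + c) \<subseteq> ?C"
    using Poly_Mapping.keys_add[of b c] by auto
  show ?thesis
    using * by (simp add: lam_ext_superset[of ?A _ ?C] lookup_add algebra_simps sum.distrib)
qed

lemma lam_ext_zero [simp]: "lam_ext L 0 a = 0" "lam_ext L a 0 = 0"
  by (simp_all add: lam_ext_def)

lemma lam_ext_single [simp]:
  "lam_ext L (Poly_Mapping.single v m) (Poly_Mapping.single w n) = m * n * L v w"
  by (simp add: lam_ext_def)

instantiation tmonom :: monoid_add
begin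

lift_definition zero_tmonom :: tmonom is "(0, 0)"
  by simp

lift_definition plus_tmonom :: "tmonom \<Rightarrow> tmonom \<Rightarrow> tmonom" is
  "\<lambda>(n, a) (m, b). (n + m + lam_ext Lam_c a b, a + b)"
  using Poly_Mapping.keys_add by fastforce

instance
  by standard (transfer; auto simp: lam_ext_add_left lam_ext_add_right add.assoc)+

end

text \<open>
  The quantum torus over \<open>\<int>[t\<^sup>\<plusminus>\<^sup>1\<^sup>/\<^sup>2]\<close>: finite integer combinations of the monomials
  \<open>t\<^sup>n\<^sup>/\<^sup>2 X\<^sup>a\<close>, with the convolution product, i.e. the integral group ring of \<open>tmonom\<close>.
\<close>

type_synonym quantum_torus = "tmonom \<Rightarrow>\<^sub>0 int"

definition t_half_torus :: quantum_torus where
  "t_half_torus = Poly_Mapping.single (tmonom (1, 0)) 1"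

definition X_torus :: "int \<Rightarrow> quantum_torus" where
  "X_torus r = Poly_Mapping.single (tmonom (0, Poly_Mapping.single r 1)) 1"

text \<open>
  A skew field of fractions of the quantum torus, the ambient skew field of all quantum cluster
  variables.  Since the quantum torus is an Ore domain, it exists and is unique up to unique
  isomorphism.
\<close>

definition skew_field_of_fractions :: "(quantum_torus \<Rightarrow> 'f::division_ring) \<Rightarrow> bool" where
  "skew_field_of_fractions \<iota> \<longleftrightarrow>
     inj \<iota> \<and> \<iota> 1 = 1 \<and> (\<forall>a b. \<iota> (a + b) = \<iota> a + \<iota> b) \<and> (\<forall>a b. \<iota> (a * b) = \<iota> a * \<iota> b) \<and>
     (\<forall>z. \<exists>a b. b \<noteq> 0 \<and> z = \<iota> a * inverse (\<iota> b))"

definition t_half :: "(quantum_torus \<Rightarrow> 'f::division_ring) \<Rightarrow> 'f" where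
  "t_half \<iota> = \<iota> t_half_torus"

definition t_var :: "(quantum_torus \<Rightarrow> 'f::division_ring) \<Rightarrow> 'f" where
  "t_var \<iota> = t_half \<iota> ^ 2"

definition initial_seed :: "(quantum_torus \<Rightarrow> 'f::division_ring) \<Rightarrow> (int, 'f) qseed" where
  "initial_seed \<iota> = \<lparr>cvar = \<lambda>r. \<iota> (X_torus r), lam = Lam_c, exch = B_c\<rparr>"

definition A_t_w0 :: "(quantum_torus \<Rightarrow> 'f::division_ring) \<Rightarrow> 'f set" where
  "A_t_w0 \<iota> = quantum_cluster_algebra (t_half \<iota>) vertices (initial_seed \<iota>)"

text \<open>
  The pair \<open>S\<^sub>k\<close>, \<open>S\<^bsub>k+1\<^esub>\<close> is related by mutation at \<open>-2 k - 2\<close>, so \<open>S\<^bsub>-(n+1)\<^esub>\<close> is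
  obtained from \<open>S\<^bsub>-n\<^esub>\<close> by mutation at \<open>2 n\<close>.
\<close>

primrec seed_up :: "(quantum_torus \<Rightarrow> 'f::division_ring) \<Rightarrow> nat \<Rightarrow> (int, 'f) qseed" where
  "seed_up \<iota> 0 = initial_seed \<iota>"
| "seed_up \<iota> (Suc n) = mutate (t_half \<iota>) (- 2 * int n - 2) (seed_up \<iota> n)"

primrec seed_down :: "(quantum_torus \<Rightarrow> 'f::division_ring) \<Rightarrow> nat \<Rightarrow> (int, 'f) qseed" where
  "seed_down \<iota> 0 = initial_seed \<iota>"
| "seed_down \<iota> (Suc n) = mutate (t_half \<iota>) (2 * int n) (seed_down \<iota> n)"

definition seed :: "(quantum_torus \<Rightarrow> 'f::division_ring) \<Rightarrow> int \<Rightarrow> (int, 'f) qseed" where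
  "seed \<iota> k = (if k \<ge> 0 then seed_up \<iota> (nat k) else seed_down \<iota> (nat (- k)))"

lemma seed_0: "seed \<iota> 0 = initial_seed \<iota>"
  by (simp add: seed_def)

lemma seed_succ: "k \<ge> 0 \<Longrightarrow> seed \<iota> (k + 1) = mutate (t_half \<iota>) (- 2 * k - 2) (seed \<iota> k)"
  by (simp add: seed_def nat_add_distrib)

lemma seed_pred: "k < 0 \<Longrightarrow> seed \<iota> k = mutate (t_half \<iota>) (- 2 * k - 2) (seed \<iota> (k + 1))"
proof -
  assume "k < 0"
  then obtain n where n: "k = - int (Suc n)"
    by (metis zero_less_imp_eq_int neg_0_less_iff_less minus_minus gr0_conv_Suc of_nat_0_less_iff)
  show ?thesis
  proof (cases n)
    case 0
    then show ?thesis using n by (simp add: seed_def)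
  next
    case (Suc m)
    moreover have "nat (- (k + 1)) = n" "nat (- k) = Suc n" using n by auto
    ultimately show ?thesis using n by (simp add: seed_def)
  qed
qed

text \<open>
  \<open>Q_omega \<iota> r\<close> and \<open>Q_s_omega \<iota> r\<close> are \<open>Q\<^bsub>\<omega>,q^r\<^esub>\<close> and \<open>Q\<^bsub>s(\<omega>),q^r\<^esub>\<close> for even \<open>r\<close>, both read off in
  the seed \<open>S\<^sub>k\<close> with \<open>r = -2 k\<close>, at the vertices \<open>r\<close> and \<open>r - 2\<close>.  The choice of \<open>k\<close> is
  immaterial by \<open>cvar_seed_ge\<close> and \<open>cvar_seed_le\<close> below.
\<close>

definition Q_omega :: "(quantum_torus \<Rightarrow> 'f::division_ring) \<Rightarrow> int \<Rightarrow> 'f" where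
  "Q_omega \<iota> r = cvar (seed \<iota> (- (r div 2))) r"

definition Q_s_omega :: "(quantum_torus \<Rightarrow> 'f::division_ring) \<Rightarrow> int \<Rightarrow> 'f" where
  "Q_s_omega \<iota> r = cvar (seed \<iota> (- (r div 2))) (r - 2)"

lemma cvar_mutate_other: "v \<noteq> k \<Longrightarrow> cvar (mutate h k S) v = cvar S v"
  by (simp add: mutate_def)

lemma cvar_seed_succ_other:
  "r \<noteq> - 2 * k - 2 \<Longrightarrow> cvar (seed \<iota> (k + 1)) r = cvar (seed \<iota> k) r"
  by (cases "k \<ge> 0") (simp_all add: seed_succ seed_pred cvar_mutate_other)

lemma cvar_seed_ge:
  assumes "even r" "r \<ge> - 2 * k"
  shows "cvar (seed \<iota> k) r = Q_omega \<iota> r"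
proof -
  from \<open>even r\<close> obtain m where r: "r = 2 * m" by blast
  have "- m \<le> k" using assms r by simp
  then have "cvar (seed \<iota> k) r = cvar (seed \<iota> (- m)) r"
  proof (induction k rule: int_ge_induct)
    case (step i)
    then show ?case using cvar_seed_succ_other[of r i \<iota>] r by simp
  qed simp
  then show ?thesis using r by (simp add: Q_omega_def)
qed

lemma cvar_seed_le:
  assumes "even r" "r \<le> - 2 * k - 2"
  shows "cvar (seed \<iota> k) r = Q_s_omega \<iota> (r + 2)"
proof -
  from \<open>even r\<close> obtain m where r: "r = 2 * m" by blast
  have "k \<le> - m - 1" using assms r by simp
  then have "cvar (seed \<iota> k) r = cvar (seed \<iota> (- m - 1)) r"
  proof (induction k rule: int_le_induct)
    case (step i)
    then show ?case using cvar_seed_succ_other[of r "i - 1" \<iota>] r by simp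
  qed simp
  moreover have "- ((r + 2) div 2) = - m - 1" using r by simp
  ultimately show ?thesis by (simp add: Q_s_omega_def)
qed

lemma seed_in_mutation_class:
  "seed \<iota> k \<in> mutation_class (t_half \<iota>) vertices (initial_seed \<iota>)"
proof -
  have "seed_up \<iota> n \<in> mutation_class (t_half \<iota>) vertices (initial_seed \<iota>)" for n
    by (induction n) (auto simp: vertices_def intro: mutation_class.intros)
  moreover have "seed_down \<iota> n \<in> mutation_class (t_half \<iota>) vertices (initial_seed \<iota>)" for n
    by (induction n) (auto simp: vertices_def intro: mutation_class.intros)
  ultimately show ?thesis by (simp add: seed_def)
qed

lemma Q_in_A_t_w0:
  assumes "even r"
  shows "Q_omega \<iota> r \<in> A_t_w0 \<iota>" "Q_s_omega \<iota> r \<in> A_t_w0 \<iota>"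
  using assms seed_in_mutation_class
  by (auto simp: Q_omega_def Q_s_omega_def A_t_w0_def vertices_def
           intro!: quantum_cluster_algebra.cluster_variable)

end

theory Submission
  imports Defs
begin

text \<open>
  Both equations are one exchange relation, multiplied by the variable that is exchanged once from
  the right and once from the left.  The seeds \<open>S\<^sub>k\<close> and \<open>S\<^bsub>k+1\<^esub>\<close> differ by the mutation at
  \<open>m = -2 k - 2\<close>, which exchanges \<open>Q\<^bsub>s(\<omega>),q^r\<^esub>\<close> and \<open>Q\<^bsub>\<omega>,q^(r-2)\<^esub>\<close> for \<open>r = -2 k\<close>.  In \<open>S\<^sub>k\<close> the vertex
  \<open>m\<close> is a sink and in \<open>S\<^bsub>k+1\<^esub>\<close> it is a source; in both quivers its only neighbours are \<open>m - 2\<close> and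
  \<open>m + 2\<close>, which carry \<open>Q\<^bsub>s(\<omega>),q^(r-2)\<^esub>\<close> and \<open>Q\<^bsub>\<omega>,q^r\<^esub>\<close>.  So the new variable at \<open>m\<close> is
  \<open>M(-e\<^sub>m) + M(-e\<^sub>m + e\<^bsub>m-2\<^esub> + e\<^bsub>m+2\<^esub>)\<close>.  Multiplication by \<open>M(e\<^sub>m)\<close> turns the first summand into \<open>1\<close>
  and the second into \<open>M(e\<^bsub>m-2\<^esub> + e\<^bsub>m+2\<^esub>)\<close> times a power of \<open>t\<^sup>1\<^sup>/\<^sup>2\<close> with exponent
  \<open>\<plusminus>(\<Lambda>(e\<^bsub>m-2\<^esub>, e\<^sub>m) + \<Lambda>(e\<^bsub>m+2\<^esub>, e\<^sub>m))\<close>.  Compatibility of \<open>\<Lambda>\<close> and \<open>B\<close> fixes this number to be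
  \<open>\<plusminus>2\<close>, whence the factors \<open>t\<close> and \<open>t\<^sup>-\<^sup>1\<close>, and it makes the two neighbours commute, so that
  \<open>M(e\<^bsub>m-2\<^esub> + e\<^bsub>m+2\<^esub>)\<close> is their plain product (\<open>exchange_relations\<close>).

  What remains is to know the data of every \<open>S\<^sub>k\<close>.  Mutation at such a sink or source only changes
  the sign of the entries of \<open>B\<close> and \<open>\<Lambda>\<close> in the row and column of \<open>m\<close>, and keeps the variables
  quasi-commuting.  Translation of the initial quiver and of \<open>\<Lambda>\<^sub>c\<close> by \<open>-2\<close> has the same effect, so by
  induction in both directions \<open>S\<^sub>k\<close> carries the initial matrices translated by \<open>-2 k\<close>
  (\<open>standard_seed_seed\<close>).  The variable that is inverted in a mutation away from \<open>S\<^sub>0\<close> is always an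
  initial one, hence nonzero.
\<close>

section \<open>Quasi-commutation in a division ring\<close>

definition quasi_commuting :: "'f::division_ring \<Rightarrow> 'v set \<Rightarrow> ('v, 'f) qseed \<Rightarrow> bool" where
  "quasi_commuting h V S \<longleftrightarrow>
     (\<forall>v\<in>V. \<forall>w\<in>V. cvar S v * cvar S w = h powi (2 * lam S v w) * (cvar S w * cvar S v))"

lemma central_powi:
  fixes h :: "'f::division_ring"
  assumes "\<And>x. h * x = x * h"
  shows "h powi n * x = x * h powi n"
proof -
  have pow: "g ^ m * x = x * g ^ m" if "g * x = x * g" for g and m
  proof (induction m)
    case (Suc m)
    have "g ^ Suc m * x = g * (g ^ m * x)" by (simp add: mult.assoc)
    also have "\<dots> = (g * x) * g ^ m" by (simp only: Suc.IH mult.assoc)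
    also have "\<dots> = x * g ^ Suc m" by (simp add: that mult.assoc)
    finally show ?case .
  qed simp
  have "inverse h * x = x * inverse h"
    by (cases "h = 0") (simp_all add: mult_commute_imp_mult_inverse_commute assms)
  with pow assms show ?thesis by (simp add: power_int_def)
qed

lemma central_powi_left:
  fixes h :: "'f::division_ring"
  assumes "\<And>x. h * x = x * h"
  shows "x * (h powi n * y) = h powi n * (x * y)"
  by (simp add: central_powi[OF assms, of n x] flip: mult.assoc)

lemma inverse_quasi_commute:
  fixes h x y :: "'f::division_ring"
  assumes "\<And>x. h * x = x * h" "h \<noteq> 0" "y \<noteq> 0" "y * x = h powi n * (x * y)"
  shows "inverse y * x = h powi (- n) * (x * inverse y)"
proof -
  have "x * inverse y = inverse y * (y * x) * inverse y"
    using assms(3) by (simp add: mult.assoc[symmetric])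
  also have "\<dots> = inverse y * (h powi n * (x * y)) * inverse y" by (simp add: assms(4))
  also have "\<dots> = h powi n * (inverse y * x)"
    using assms(3) by (simp add: mult.assoc central_powi_left[OF assms(1), of "inverse y"])
  finally show ?thesis using assms(2)
    by (simp add: mult.assoc[symmetric] power_int_minus)
qed

lemma product_quasi_commute:
  fixes h x y z :: "'f::division_ring"
  assumes "\<And>x. h * x = x * h" "h \<noteq> 0"
    and "y * x = h powi n * (x * y)" "z * x = h powi l * (x * z)"
  shows "(y * z) * x = h powi (n + l) * (x * (y * z))"
proof -
  have "(y * z) * x = y * (h powi l * (x * z))" by (simp add: mult.assoc assms(4))
  also have "\<dots> = h powi l * ((y * x) * z)"
    by (simp add: mult.assoc central_powi_left[OF assms(1)])
  also have "\<dots> = h powi l * h powi n * (x * (y * z))" by (simp add: assms(3) mult.assoc)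
  also have "h powi l * h powi n = h powi (n + l)"
    using assms(2) by (simp add: power_int_add add.commute)
  finally show ?thesis .
qed

section \<open>Mutation at a sink or source with two neighbours\<close>

lemma frame_neg_single:
  "frame h S (Poly_Mapping.single m (-1)) = inverse (cvar S m)"
proof -
  have keys: "Poly_Mapping.keys (Poly_Mapping.single m (-1::int)) = {m}" by simp
  have sum: "(\<Sum>v\<in>{m}. F v) = F m" for F :: "_ \<Rightarrow> int" by simp
  have above: "{w \<in> {m}. m < w} = {}" by auto
  show ?thesis
    unfolding frame_def keys sum above by (simp add: power_int_minus)
qed

lemma frame_three_term:
  fixes p m q :: "'v::linorder"
  assumes "p < m" "m < q"
  shows "frame h S (Poly_Mapping.single m (-1) + (Poly_Mapping.single p 1 + Poly_Mapping.single q 1)) =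
    h powi (lam S p m + lam S m q - lam S p q) * (cvar S p * (inverse (cvar S m) * cvar S q))"
    (is "frame h S ?a = _")
proof -
  have ne: "p \<noteq> m" "m \<noteq> q" "p \<noteq> q" "p < q" "\<not> m < p" "\<not> q < m" "\<not> q < p" using assms by auto
  have look: "Poly_Mapping.lookup ?a v = (if v = m then -1 else if v = p \<or> v = q then 1 else 0)" for v
    using ne by (auto simp: lookup_add lookup_single when_def)
  have keys: "Poly_Mapping.keys ?a = {p, m, q}"
    unfolding in_keys_iff set_eq_iff look by (auto simp: in_keys_iff look simp del: lookup_add)
  have above: "{w \<in> {p, m, q}. p < w} = {m, q}" "{w \<in> {p, m, q}. m < w} = {q}" "{w \<in> {p, m, q}. q < w} = {}"
    using assms ne by auto
  have sorted: "sorted_list_of_set {p, m, q} = [p, m, q]"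
    using sorted_list_of_set.idem_if_sorted_distinct[of "[p, m, q]"] ne assms by (simp add: order.strict_implies_order)
  have sum: "(\<Sum>v\<in>{p, m, q}. F v) = F p + F m + F q" "(\<Sum>v\<in>{m, q}. F v) = F m + F q"
    "(\<Sum>v\<in>{q}. F v) = F q" for F :: "'v \<Rightarrow> int"
    using ne by simp_all
  show ?thesis
    unfolding frame_def keys sorted sum above look using ne
    by (simp add: algebra_simps)
qed

text \<open>
  The sign \<open>s\<close> is \<open>1\<close> if \<open>m\<close> is a sink and \<open>-1\<close> if it is a source.  The assumption \<open>compatible\<close> is the
  row of \<open>m\<close> in the relation \<open>B\<^sup>T \<Lambda> = D\<close> that defines a compatible pair, with diagonal entry
  of absolute value \<open>2\<close>.
\<close>

locale sink_or_source =
  fixes h :: "'f::division_ring" and V :: "'v::linorder set" and S :: "('v, 'f) qseed"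
    and p m q :: 'v and s :: int
  assumes central: "h * x = x * h" and h_nonzero: "h \<noteq> 0"
    and order: "p < m" "m < q" and in_V: "p \<in> V" "m \<in> V" "q \<in> V"
    and sign: "s = 1 \<or> s = -1"
    and exch_skew: "exch S v w = - exch S w v"
    and exch_column: "exch S w m = s * (of_bool (w = p) + of_bool (w = q))"
    and lam_skew: "v \<in> V \<Longrightarrow> w \<in> V \<Longrightarrow> lam S v w = - lam S w v"
    and compatible: "w \<in> V \<Longrightarrow> lam S p w + lam S q w = (if w = m then - 2 * s else 0)"
    and quasi: "quasi_commuting h V S"
    and var_nonzero: "cvar S m \<noteq> 0"
begin

lemma exch_vectors:
  defines "N \<equiv> Poly_Mapping.single m (-1 :: int)"
    and "E \<equiv> Poly_Mapping.single p (1 :: int) + Poly_Mapping.single q 1"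
  shows "s = 1 \<Longrightarrow> exch_pos S m = N + E \<and> exch_neg S m = N"
    and "s = -1 \<Longrightarrow> exch_pos S m = N \<and> exch_neg S m = N + E"
proof -
  have N: "- Poly_Mapping.single m (1 :: int) = N" by (simp add: N_def single_uminus)
  have pq: "p \<noteq> q" "q \<noteq> p" using order by auto
  {
    assume s: "s = 1"
    have "{w. exch S w m > 0} = {p, q}" "{w. exch S w m < 0} = {}"
      using s pq by (auto simp: exch_column)
    moreover have "exch S p m = 1" "exch S q m = 1" using s pq by (auto simp: exch_column)
    ultimately show "exch_pos S m = N + E \<and> exch_neg S m = N"
      using pq by (simp add: exch_pos_def exch_neg_def N E_def)
  next
    assume s: "s = -1"
    have "{w. exch S w m < 0} = {p, q}" "{w. exch S w m > 0} = {}"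
      using s pq by (auto simp: exch_column)
    moreover have "exch S p m = -1" "exch S q m = -1" using s pq by (auto simp: exch_column)
    ultimately show "exch_pos S m = N \<and> exch_neg S m = N + E"
      using pq by (simp add: exch_pos_def exch_neg_def N E_def single_uminus)
  }
qed

text \<open>
  Compatibility at \<open>q\<close> gives \<open>\<Lambda>(p, q) = 0\<close>.  The entry \<open>\<Lambda>(p, m)\<close> stays free: only the sum
  \<open>\<Lambda>(p, m) + \<Lambda>(q, m)\<close> is determined.
\<close>

lemma lam_simps:
  "lam S p q = 0" "lam S q p = 0" "lam S q m = - 2 * s - lam S p m"
  "lam S m p = - lam S p m" "lam S m q = 2 * s + lam S p m"
  "lam S m m = 0" "lam S p p = 0" "lam S q q = 0"
proof -
  have self: "v \<in> V \<Longrightarrow> lam S v v = 0" for v using lam_skew[of v v] by simp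
  from self in_V show "lam S m m = 0" "lam S p p = 0" "lam S q q = 0" by auto
  with compatible[of q] compatible[of p] order in_V show "lam S p q = 0" "lam S q p = 0" by auto
  from compatible[of m] in_V show "lam S q m = - 2 * s - lam S p m" by simp
  with lam_skew[of m p] lam_skew[of m q] in_V
  show "lam S m p = - lam S p m" "lam S m q = 2 * s + lam S p m" by auto
qed

lemma new_variable:
  "cvar (mutate h m S) m =
     inverse (cvar S m) + h powi (2 * s + 2 * lam S p m) * (cvar S p * (inverse (cvar S m) * cvar S q))"
proof -
  have e: "lam S p m + lam S m q - lam S p q = 2 * s + 2 * lam S p m" by (simp add: lam_simps)
  have "cvar (mutate h m S) m = frame h S (exch_pos S m) + frame h S (exch_neg S m)"
    by (simp add: mutate_def)
  also have "\<dots> = frame h S (Poly_Mapping.single m (-1)) +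
      frame h S (Poly_Mapping.single m (-1) + (Poly_Mapping.single p 1 + Poly_Mapping.single q 1))"
    using sign
  proof
    assume "s = 1"
    with exch_vectors(1) show ?thesis by (metis add.commute)
  next
    assume "s = -1"
    with exch_vectors(2) show ?thesis by simp
  qed
  finally show ?thesis
    by (simp only: frame_neg_single frame_three_term[OF order] e)
qed

lemma commute: "v \<in> V \<Longrightarrow> w \<in> V \<Longrightarrow> cvar S v * cvar S w = h powi (2 * lam S v w) * (cvar S w * cvar S v)"
  using quasi unfolding quasi_commuting_def by blast

text \<open>
  The unknown \<open>\<Lambda>(p, m)\<close> in the normalisation of the frame cancels against the power of \<open>t\<close> that
  appears when \<open>cvar S m\<close> is moved past one of its neighbours.
\<close>

lemma exchange_relations:
  "cvar (mutate h m S) m * cvar S m = 1 + h powi (- 2 * s) * (cvar S q * cvar S p)"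
  "cvar S m * cvar (mutate h m S) m = 1 + h powi (2 * s) * (cvar S q * cvar S p)"
proof -
  let ?a = "cvar S p" and ?b = "cvar S q" and ?y = "cvar S m" and ?e = "2 * s + 2 * lam S p m"
  have ab: "?a * ?b = ?b * ?a" using commute[of p q] in_V lam_simps by simp
  have b_y: "?b * ?y = h powi (2 * lam S q m) * (?y * ?b)" by (intro commute in_V)
  have ya: "?y * ?a = h powi (2 * lam S m p) * (?a * ?y)" by (intro commute in_V)
  have "h powi ?e * (?a * (inverse ?y * ?b)) * ?y = h powi ?e * ((?a * inverse ?y) * (?b * ?y))"
    by (simp add: mult.assoc)
  also have "\<dots> = h powi ?e * (h powi (2 * lam S q m) * ((?a * inverse ?y) * (?y * ?b)))"
    unfolding b_y central_powi_left[OF central, of "?a * inverse ?y"] ..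
  also have "\<dots> = h powi ?e * h powi (2 * lam S q m) * (?a * (inverse ?y * ?y * ?b))"
    by (simp only: mult.assoc)
  also have "h powi ?e * h powi (2 * lam S q m) = h powi (?e + 2 * lam S q m)"
    using h_nonzero by (simp add: power_int_add)
  also have "?e + 2 * lam S q m = - 2 * s" by (simp add: lam_simps)
  finally show "cvar (mutate h m S) m * ?y = 1 + h powi (- 2 * s) * (?b * ?a)"
    using var_nonzero by (simp add: new_variable distrib_right ab)
  have "?y * (h powi ?e * (?a * (inverse ?y * ?b))) = h powi ?e * (?y * ?a) * (inverse ?y * ?b)"
    by (simp only: central_powi_left[OF central, of ?y] mult.assoc)
  also have "\<dots> = h powi ?e * h powi (2 * lam S m p) * (?a * (?y * inverse ?y * ?b))"
    unfolding ya by (simp only: mult.assoc)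
  also have "h powi ?e * h powi (2 * lam S m p) = h powi (?e + 2 * lam S m p)"
    using h_nonzero by (simp add: power_int_add)
  also have "?e + 2 * lam S m p = 2 * s" by (simp add: lam_simps)
  finally show "?y * cvar (mutate h m S) m = 1 + h powi (2 * s) * (?b * ?a)"
    using var_nonzero by (simp add: new_variable distrib_left ab)
qed

text \<open>
  For \<open>w \<noteq> m\<close> the contributions of \<open>p\<close> and \<open>q\<close> cancel by compatibility, so \<open>exch_pos S m\<close> pairs with
  \<open>w\<close> like \<open>-e\<^sub>m\<close>, whether or not it contains \<open>e\<^sub>p + e\<^sub>q\<close>.
\<close>

lemma lam_mutate:
  assumes "v \<in> V" "w \<in> V"
  shows "lam (mutate h m S) v w = (if v = m \<or> w = m then - lam S v w else lam S v w)"
proof -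
  have skew_sum: "lam S v p + lam S v q = - (lam S p v + lam S q v)" if "v \<in> V" for v
    using lam_skew[of v p] lam_skew[of v q] that in_V by simp
  have right: "lam S v q = - lam S v p" if "v \<in> V" "v \<noteq> m" for v
    using skew_sum[of v] compatible[of v] that by simp
  have left: "lam S q v = - lam S p v" if "v \<in> V" "v \<noteq> m" for v
    using compatible[of v] that by simp
  show ?thesis
    using sign
  proof
    assume "s = 1"
    with exch_vectors(1) assms show ?thesis
      by (auto simp: mutate_def exch_basis_def lam_ext_add_left lam_ext_add_right lam_simps left right)
  next
    assume "s = -1"
    with exch_vectors(2) assms show ?thesis
      by (auto simp: mutate_def exch_basis_def lam_simps)
  qed
qed

text \<open>
  At a sink or source no path of length two passes through \<open>m\<close>, so no arrow between other vertices
  is created or cancelled.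
\<close>

lemma exch_mutate:
  "exch (mutate h m S) v w = (if v = m \<or> w = m then - exch S v w else exch S v w)"
proof -
  have row: "exch S m w = - s * (of_bool (w = p) + of_bool (w = q))" for w
    by (subst exch_skew) (simp add: exch_column)
  have "\<bar>exch S v m\<bar> * exch S m w + exch S v m * \<bar>exch S m w\<bar> = 0"
    using sign by (auto simp: row exch_column)
  then show ?thesis by (simp add: mutate_def)
qed

text \<open>
  By compatibility both summands of the new variable commute with \<open>cvar S w\<close> up to the same power
  of \<open>t\<close>.
\<close>

lemma quasi_commuting_mutate: "quasi_commuting h V (mutate h m S)"
proof -
  let ?a = "cvar S p" and ?b = "cvar S q" and ?y = "cvar S m" and ?e = "2 * s + 2 * lam S p m"
  let ?x = "cvar (mutate h m S) m"
  have left: "?x * cvar S w = h powi (2 * lam (mutate h m S) m w) * (cvar S w * ?x)"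
    if w: "w \<in> V" "w \<noteq> m" for w
  proof -
    let ?z = "cvar S w" and ?n = "- (2 * lam S m w)"
    have y: "inverse ?y * ?z = h powi ?n * (?z * inverse ?y)"
      by (intro inverse_quasi_commute[OF central h_nonzero var_nonzero] commute in_V w)
    have "(?a * (inverse ?y * ?b)) * ?z = h powi (2 * lam S p w + (?n + 2 * lam S q w)) * (?z * (?a * (inverse ?y * ?b)))"
      by (intro product_quasi_commute[OF central h_nonzero] y commute in_V w)
    also have "2 * lam S p w + (?n + 2 * lam S q w) = ?n" using compatible[of w] w by simp
    finally have ab: "(?a * (inverse ?y * ?b)) * ?z = h powi ?n * (?z * (?a * (inverse ?y * ?b)))" .
    have "h powi ?e * (?a * (inverse ?y * ?b)) * ?z = h powi ?e * (h powi ?n * (?z * (?a * (inverse ?y * ?b))))"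
      unfolding ab[symmetric] by (simp only: mult.assoc)
    also have "\<dots> = h powi ?n * (?z * (h powi ?e * (?a * (inverse ?y * ?b))))"
      using central_powi_left[OF central, of "h powi ?n * ?z" ?e "?a * (inverse ?y * ?b)", symmetric]
      by (simp only: mult.assoc)
    finally have "h powi ?e * (?a * (inverse ?y * ?b)) * ?z = h powi ?n * (?z * (h powi ?e * (?a * (inverse ?y * ?b))))" .
    with y have "?x * ?z = h powi ?n * (?z * ?x)"
      unfolding new_variable distrib_left distrib_right by (simp only:)
    with w in_V show ?thesis by (simp only: lam_mutate) simp
  qed
  have right: "cvar S w * ?x = h powi (2 * lam (mutate h m S) w m) * (?x * cvar S w)"
    if w: "w \<in> V" "w \<noteq> m" for w
  proof -
    have "2 * lam (mutate h m S) w m = - (2 * lam (mutate h m S) m w)"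
      using lam_skew[of w m] w in_V by (simp add: lam_mutate)
    then show ?thesis
      unfolding left[OF w] using h_nonzero by (simp add: power_int_minus flip: mult.assoc)
  qed
  show ?thesis
    unfolding quasi_commuting_def
  proof (intro ballI)
    fix v w assume vw: "v \<in> V" "w \<in> V"
    let ?S = "mutate h m S"
    consider "v = m" "w = m" | "v = m" "w \<noteq> m" | "v \<noteq> m" "w = m" | "v \<noteq> m" "w \<noteq> m" by blast
    then show "cvar ?S v * cvar ?S w = h powi (2 * lam ?S v w) * (cvar ?S w * cvar ?S v)"
    proof cases
      case 1
      then show ?thesis by (simp add: lam_mutate in_V lam_simps)
    next
      case 2
      with left[OF vw(2) 2(2)] show ?thesis by (simp only: cvar_mutate_other not_False_eq_True)
    next
      case 3
      with right[OF vw(1) 3(1)] show ?thesis by (simp only: cvar_mutate_other not_False_eq_True)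
    next
      case 4
      with vw have "lam ?S v w = lam S v w" by (simp add: lam_mutate)
      with 4 commute[OF vw] show ?thesis by (simp only: cvar_mutate_other not_False_eq_True)
    qed
  qed
qed

end

section \<open>The translated initial matrices\<close>

definition Lam_at :: "int \<Rightarrow> int \<Rightarrow> int \<Rightarrow> int" where
  "Lam_at k v w = Lam_c (v + 2 * k) (w + 2 * k)"

definition B_at :: "int \<Rightarrow> int \<Rightarrow> int \<Rightarrow> int" where
  "B_at k v w = B_c (v + 2 * k) (w + 2 * k)"

lemma f_odd_parity: "f_odd n = (if even n then 0 else - sgn n)"
  by (auto simp: f_odd_def even_nat_iff sgn_if)

lemma Lam_at_skew: "even v \<Longrightarrow> even w \<Longrightarrow> Lam_at k v w = - Lam_at k w v"
  by (auto simp: Lam_at_def Lam_c_def Lam_e_def f_odd_parity sgn_if elim!: evenE)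

lemma B_at_skew: "B_at k v w = - B_at k w v"
  by (simp add: B_at_def B_c_def)

text \<open>
  \<open>\<Lambda>\<^sub>e\<close> depends only on the difference of its arguments, so a translation acts through the signs
  \<open>\<epsilon>\<close> alone, and among even vertices these change at one place.
\<close>

lemma Lam_at_shift:
  assumes "even v" "even w"
  shows "Lam_at (k + 1) v w =
    (if v = - 2 * k - 2 \<or> w = - 2 * k - 2 then - Lam_at k v w else Lam_at k v w)"
proof -
  have eps: "eps (v + 2 * (k + 1)) = (if v = - 2 * k - 2 then - eps (v + 2 * k) else eps (v + 2 * k))"
    if "even v" for v using that unfolding eps_def by (auto; presburger)
  show ?thesis
    unfolding Lam_at_def Lam_c_def Lam_e_def eps[OF assms(1)] eps[OF assms(2)]
    by (auto simp: f_odd_parity)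
qed

lemma arrow_c_shift:
  "arrow_c (x + 2) (y + 2) \<longleftrightarrow> (if x = -2 \<or> y = -2 then arrow_c y x else arrow_c x y)"
  unfolding arrow_c_def vertices_def mem_Collect_eq by presburger

lemma B_at_shift:
  "B_at (k + 1) v w = (if v = - 2 * k - 2 \<or> w = - 2 * k - 2 then - B_at k v w else B_at k v w)"
proof -
  have B_c_shift: "B_c (x + 2) (y + 2) = (if x = -2 \<or> y = -2 then - B_c x y else B_c x y)" for x y
    unfolding B_c_def arrow_c_shift by (auto simp only: if_cancel if_True if_False minus_diff_eq split: if_split)
  have "v + 2 * (k + 1) = (v + 2 * k) + 2" "w + 2 * (k + 1) = (w + 2 * k) + 2"
    "v = - 2 * k - 2 \<longleftrightarrow> v + 2 * k = -2" "w = - 2 * k - 2 \<longleftrightarrow> w + 2 * k = -2" by auto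
  then show ?thesis unfolding B_at_def by (simp only: B_c_shift)
qed

lemma B_at_column:
  "B_at k w (- 2 * k - 2) = of_bool (w = - 2 * k - 4) + of_bool (w = - 2 * k)"
proof -
  have "arrow_c x (-2) \<longleftrightarrow> x = -4 \<or> x = 0" "\<not> arrow_c (-2) x" for x
    by (auto simp: arrow_c_def vertices_def)
  moreover have "w = - 2 * k - 4 \<longleftrightarrow> w + 2 * k = -4" "w = - 2 * k \<longleftrightarrow> w + 2 * k = 0" by auto
  ultimately show ?thesis by (auto simp: B_at_def B_c_def)
qed

lemma Lam_at_compatible:
  assumes "even w"
  shows "Lam_at k (- 2 * k - 4) w + Lam_at k (- 2 * k) w = (if w = - 2 * k - 2 then - 2 else 0)"
proof -
  from assms obtain n where n: "w + 2 * k = 2 * n" by (metis dvd_add dvd_triv_left evenE)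
  have "Lam_c (-4) (2 * n) + Lam_c 0 (2 * n) = eps (2 * n) * (f_odd n - f_odd (n + 2))"
    by (simp add: Lam_c_def Lam_e_def eps_def algebra_simps)
  also have "\<dots> = (if n = -1 then - 2 else 0)"
  proof (cases "n = -1 \<or> even n")
    case False
    then have "n \<noteq> -2" "n \<noteq> 0" by auto
    with False have "sgn (n + 2) = sgn n" by (simp add: sgn_if)
    with False show ?thesis by (simp add: f_odd_parity)
  qed (auto simp: f_odd_parity eps_def)
  also have "n = -1 \<longleftrightarrow> w = - 2 * k - 2" using n by auto
  finally show ?thesis by (simp add: Lam_at_def n)
qed

section \<open>Quasi-commutation in the skew field of fractions\<close>

lemma tmonom_add:
  assumes "Poly_Mapping.keys a \<subseteq> vertices" "Poly_Mapping.keys b \<subseteq> vertices"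
  shows "tmonom (n, a) + tmonom (l, b) = tmonom (n + l + lam_ext Lam_c a b, a + b)"
  using assms keys_add[of a b]
  by (subst plus_tmonom.abs_eq) (auto simp: eq_onp_def)

lemma t_half_torus_central: "t_half_torus * a = a * t_half_torus"
proof (induction a rule: Poly_Mapping.update_induct)
  case const
  show ?case by simp
next
  case (update f x c)
  have "Poly_Mapping.update x c f = f + Poly_Mapping.single x c"
    using update.hyps by (intro poly_mapping_eqI) (auto simp: lookup_update lookup_add lookup_single in_keys_iff)
  moreover have "tmonom (1, 0) + x = x + tmonom (1, 0)"
    by (cases x rule: tmonom_cases) (auto simp: tmonom_add add.commute)
  ultimately show ?case
    using update.IH by (simp add: distrib_left distrib_right t_half_torus_def mult_single)
qed

locale quantum_torus_fractions =
  fixes \<iota> :: "quantum_torus \<Rightarrow> 'f::division_ring"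
  assumes fractions: "skew_field_of_fractions \<iota>"
begin

lemma \<iota>_hom: "\<iota> 1 = 1" "\<iota> (a * b) = \<iota> a * \<iota> b" "\<iota> 0 = 0"
proof -
  show "\<iota> 1 = 1" "\<iota> (a * b) = \<iota> a * \<iota> b"
    using fractions by (auto simp: skew_field_of_fractions_def)
  have "\<iota> (0 + 0) = \<iota> 0 + \<iota> 0" using fractions unfolding skew_field_of_fractions_def by blast
  then show "\<iota> 0 = 0" by simp
qed

lemma \<iota>_single_nonzero: "\<iota> (Poly_Mapping.single x 1) \<noteq> 0"
proof
  assume "\<iota> (Poly_Mapping.single x 1) = 0"
  then have "\<iota> (Poly_Mapping.single x 1) = \<iota> 0" by (simp add: \<iota>_hom)
  with fractions have "Poly_Mapping.single x (1::int) = 0"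
    unfolding skew_field_of_fractions_def inj_def by blast
  then have "Poly_Mapping.lookup (Poly_Mapping.single x (1::int)) x = 0" by simp
  then show False by simp
qed

lemma t_half_nonzero: "t_half \<iota> \<noteq> 0"
  by (simp add: t_half_def t_half_torus_def \<iota>_single_nonzero)

lemma t_half_central: "t_half \<iota> * z = z * t_half \<iota>"
proof -
  obtain a b where z: "z = \<iota> a * inverse (\<iota> b)"
    using fractions unfolding skew_field_of_fractions_def by blast
  have comm: "t_half \<iota> * \<iota> c = \<iota> c * t_half \<iota>" for c
    by (simp add: t_half_def t_half_torus_central flip: \<iota>_hom(2))
  have "t_half \<iota> * inverse (\<iota> b) = inverse (\<iota> b) * t_half \<iota>"
    by (cases "\<iota> b = 0") (simp_all add: mult_commute_imp_mult_inverse_commute comm)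
  then show ?thesis unfolding z by (metis comm mult.assoc)
qed

lemma \<iota>_power_t: "\<iota> (Poly_Mapping.single (tmonom (n, 0)) 1) = t_half \<iota> powi n"
proof -
  let ?u = "\<lambda>n. \<iota> (Poly_Mapping.single (tmonom (n, 0)) 1)"
  have add: "?u (n + l) = ?u n * ?u l" for n l
    by (simp add: mult_single tmonom_add flip: \<iota>_hom(2))
  have "tmonom (0, 0) = 0" by (simp add: zero_tmonom.abs_eq)
  then have zero: "?u 0 = 1" by (simp add: \<iota>_hom)
  have nat: "?u (int l) = t_half \<iota> ^ l" for l
    by (induction l) (simp_all add: zero add t_half_def t_half_torus_def)
  show ?thesis
  proof (cases "n \<ge> 0")
    case True
    then show ?thesis using nat[of "nat n"] by (simp add: power_int_def)
  next
    case False
    have "?u n * ?u (- n) = 1" using add[of n "- n"] zero by simp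
    then have "?u n = inverse (?u (- n))" by (metis inverse_inverse_eq inverse_unique)
    with False nat[of "nat (- n)"] show ?thesis by (simp add: power_int_def power_inverse)
  qed
qed

lemma X_commute:
  assumes "even v" "even w"
  shows "\<iota> (X_torus v) * \<iota> (X_torus w) =
    t_half \<iota> powi (2 * Lam_c v w) * (\<iota> (X_torus w) * \<iota> (X_torus v))"
proof -
  have "Lam_c w v = - Lam_c v w" using Lam_at_skew[OF assms, of 0] by (simp add: Lam_at_def)
  moreover have "Poly_Mapping.keys (Poly_Mapping.single w (1 :: int) + Poly_Mapping.single v 1) \<subseteq> vertices"
    using assms keys_add[of "Poly_Mapping.single w (1 :: int)" "Poly_Mapping.single v 1"]
    by (auto simp: vertices_def)
  ultimately show ?thesis
    using assms unfolding X_torus_def \<iota>_power_t[symmetric]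
    by (simp add: mult_single tmonom_add vertices_def lam_ext_add_right add.commute[of "Poly_Mapping.single v 1"] flip: \<iota>_hom(2))
qed

section \<open>The seeds between which the variables are exchanged\<close>

text \<open>
  The matrix \<open>\<Lambda>\<close> is prescribed on the even vertices only.  A translation by \<open>2\<close> also moves an odd
  index across the place where \<open>\<epsilon>\<close> changes sign, while no mutation changes the sign there.
\<close>

definition standard_seed :: "int \<Rightarrow> (int, 'f) qseed \<Rightarrow> bool" where
  "standard_seed k S \<longleftrightarrow>
     (\<forall>v\<in>vertices. \<forall>w\<in>vertices. lam S v w = Lam_at k v w) \<and>
     exch S = B_at k \<and> quasi_commuting (t_half \<iota>) vertices S"

lemma standard_initial_seed: "standard_seed 0 (initial_seed \<iota>)"
proof -
  have "quasi_commuting (t_half \<iota>) vertices (initial_seed \<iota>)"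
    unfolding quasi_commuting_def initial_seed_def qseed.simps vertices_def mem_Collect_eq
    by (intro ballI X_commute) simp_all
  then show ?thesis
    by (simp add: standard_seed_def initial_seed_def Lam_at_def B_at_def fun_eq_iff)
qed

lemma standard_seed_sink:
  assumes "standard_seed k S" "cvar S (- 2 * k - 2) \<noteq> 0"
  shows "sink_or_source (t_half \<iota>) vertices S (- 2 * k - 4) (- 2 * k - 2) (- 2 * k) 1"
proof
  fix v w
  show "exch S v w = - exch S w v"
    using assms(1) B_at_skew[of _ v w] by (simp add: standard_seed_def)
  show "exch S w (- 2 * k - 2) = 1 * (of_bool (w = - 2 * k - 4) + of_bool (w = - 2 * k))"
    using assms(1) by (simp only: standard_seed_def B_at_column) simp
  show "w \<in> vertices \<Longrightarrow> lam S (- 2 * k - 4) w + lam S (- 2 * k) w = (if w = - 2 * k - 2 then - 2 * 1 else 0)"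
    using assms(1) Lam_at_compatible[of w k] by (simp add: standard_seed_def vertices_def)
  show "v \<in> vertices \<Longrightarrow> w \<in> vertices \<Longrightarrow> lam S v w = - lam S w v"
    using assms(1) Lam_at_skew[of v w k] by (simp add: standard_seed_def vertices_def)
qed (use assms t_half_central t_half_nonzero in \<open>auto simp: standard_seed_def vertices_def\<close>)

lemma standard_seed_source:
  assumes "standard_seed (k + 1) S" "cvar S (- 2 * k - 2) \<noteq> 0"
  shows "sink_or_source (t_half \<iota>) vertices S (- 2 * k - 4) (- 2 * k - 2) (- 2 * k) (-1)"
proof
  fix v w
  show "exch S v w = - exch S w v"
    using assms(1) B_at_skew[of _ v w] by (simp add: standard_seed_def)
  show "exch S w (- 2 * k - 2) = - 1 * (of_bool (w = - 2 * k - 4) + of_bool (w = - 2 * k))"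
    using assms(1) by (simp only: standard_seed_def B_at_column B_at_shift) simp
  show "w \<in> vertices \<Longrightarrow> lam S (- 2 * k - 4) w + lam S (- 2 * k) w = (if w = - 2 * k - 2 then - 2 * - 1 else 0)"
    using assms(1) Lam_at_compatible[of w k]
    by (cases "w = - 2 * k - 2") (simp_all add: standard_seed_def vertices_def Lam_at_shift)
  show "v \<in> vertices \<Longrightarrow> w \<in> vertices \<Longrightarrow> lam S v w = - lam S w v"
    using assms(1) Lam_at_skew[of v w "k + 1"] by (simp add: standard_seed_def vertices_def)
qed (use assms t_half_central t_half_nonzero in \<open>auto simp: standard_seed_def vertices_def\<close>)

lemma standard_seed_mutate_sink:
  assumes "standard_seed k S" "cvar S (- 2 * k - 2) \<noteq> 0"
  shows "standard_seed (k + 1) (mutate (t_half \<iota>) (- 2 * k - 2) S)"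
proof -
  interpret sink_or_source "t_half \<iota>" vertices S "- 2 * k - 4" "- 2 * k - 2" "- 2 * k" 1
    by (rule standard_seed_sink[OF assms])
  show ?thesis
    using assms(1) lam_mutate exch_mutate quasi_commuting_mutate
    by (auto simp: standard_seed_def fun_eq_iff B_at_shift Lam_at_shift vertices_def)
qed

lemma standard_seed_mutate_source:
  assumes "standard_seed (k + 1) S" "cvar S (- 2 * k - 2) \<noteq> 0"
  shows "standard_seed k (mutate (t_half \<iota>) (- 2 * k - 2) S)"
proof -
  interpret sink_or_source "t_half \<iota>" vertices S "- 2 * k - 4" "- 2 * k - 2" "- 2 * k" "-1"
    by (rule standard_seed_source[OF assms])
  show ?thesis
    using assms(1) lam_mutate exch_mutate quasi_commuting_mutate
    by (auto simp: standard_seed_def fun_eq_iff B_at_shift Lam_at_shift vertices_def)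
qed

text \<open>
  The variable of \<open>S\<^sub>k\<close> at \<open>-2 k - 2\<close> with \<open>k \<ge> 0\<close>, and that of \<open>S\<^bsub>k+1\<^esub>\<close> at this vertex with \<open>k < 0\<close>,
  have not been exchanged on the way from \<open>S\<^sub>0\<close>, so they are images of monomials.
\<close>

lemma unmutated_variable_nonzero:
  "k \<ge> 0 \<Longrightarrow> cvar (seed \<iota> k) (- 2 * k - 2) \<noteq> 0"
  "k < 0 \<Longrightarrow> cvar (seed \<iota> (k + 1)) (- 2 * k - 2) \<noteq> 0"
proof -
  have X: "cvar (seed \<iota> 0) v \<noteq> 0" for v
    by (simp add: seed_0 initial_seed_def X_torus_def \<iota>_single_nonzero)
  show "cvar (seed \<iota> k) (- 2 * k - 2) \<noteq> 0" if "k \<ge> 0"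
    using X[of "- 2 * k - 2"] cvar_seed_le[of "- 2 * k - 2" k \<iota>] cvar_seed_le[of "- 2 * k - 2" 0 \<iota>] that
    by simp
  show "cvar (seed \<iota> (k + 1)) (- 2 * k - 2) \<noteq> 0" if "k < 0"
    using X[of "- 2 * k - 2"] cvar_seed_ge[of "- 2 * k - 2" "k + 1" \<iota>] cvar_seed_ge[of "- 2 * k - 2" 0 \<iota>] that
    by simp
qed

lemma standard_seed_seed: "standard_seed k (seed \<iota> k)"
proof (induction k rule: int_induct[where k = 0])
  case base
  show ?case by (simp add: seed_0 standard_initial_seed)
next
  case (step1 k)
  then show ?case
    using standard_seed_mutate_sink unmutated_variable_nonzero(1) by (simp add: seed_succ)
next
  case (step2 k)
  then show ?case
    using standard_seed_mutate_source[of "k - 1"] unmutated_variable_nonzero(2)[of "k - 1"]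
    by (simp add: seed_pred[of "k - 1"])
qed

text \<open>
  For \<open>k \<ge> 0\<close> the variable \<open>Q\<^bsub>\<omega>,q^(r-2)\<^esub>\<close> is the new one, produced at a sink; for \<open>k < 0\<close> it is
  \<open>Q\<^bsub>s(\<omega>),q^r\<^esub>\<close>, produced at a source.  Left and right multiplication by the old variable are
  interchanged between the two cases, and so is the sign of the exponent of \<open>t\<close>: the resulting
  relations agree.
\<close>

lemma QQ_relations:
  fixes k :: int
  defines "r \<equiv> - 2 * k"
  shows "Q_omega \<iota> (r - 2) * Q_s_omega \<iota> r =
           1 + t_half \<iota> powi (- 2) * (Q_omega \<iota> r * Q_s_omega \<iota> (r - 2)) \<and>
        Q_s_omega \<iota> r * Q_omega \<iota> (r - 2) =
           1 + t_half \<iota> powi 2 * (Q_omega \<iota> r * Q_s_omega \<iota> (r - 2))"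
proof -
  have shift: "r - 2 + 2 = r" "r - 4 + 2 = r - 2" by simp_all
  have vertex: "- 2 * k = r" "- 2 * k - 2 = r - 2" "- 2 * k - 4 = r - 4" by (simp_all add: r_def)
  have parity: "even r" "even (r - 2)" "even (r - 4)" by (simp_all add: r_def)
  have k: "cvar (seed \<iota> k) r = Q_omega \<iota> r" "cvar (seed \<iota> k) (r - 2) = Q_s_omega \<iota> r"
    "cvar (seed \<iota> k) (r - 4) = Q_s_omega \<iota> (r - 2)"
    using cvar_seed_ge[OF parity(1), of k \<iota>] cvar_seed_le[OF parity(2), of k \<iota>]
      cvar_seed_le[OF parity(3), of k \<iota>]
    unfolding shift vertex by simp_all
  have k1: "cvar (seed \<iota> (k + 1)) r = Q_omega \<iota> r" "cvar (seed \<iota> (k + 1)) (r - 2) = Q_omega \<iota> (r - 2)"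
    "cvar (seed \<iota> (k + 1)) (r - 4) = Q_s_omega \<iota> (r - 2)"
  proof -
    have "- 2 * (k + 1) = r - 2" "- 2 * (k + 1) - 2 = r - 4" by (simp_all add: r_def)
    then show "cvar (seed \<iota> (k + 1)) r = Q_omega \<iota> r"
      "cvar (seed \<iota> (k + 1)) (r - 2) = Q_omega \<iota> (r - 2)"
      "cvar (seed \<iota> (k + 1)) (r - 4) = Q_s_omega \<iota> (r - 2)"
      using cvar_seed_ge[OF parity(1), of "k + 1" \<iota>] cvar_seed_ge[OF parity(2), of "k + 1" \<iota>]
        cvar_seed_le[OF parity(3), of "k + 1" \<iota>]
      unfolding shift by simp_all
  qed
  show ?thesis
  proof (cases "k \<ge> 0")
    case True
    have "mutate (t_half \<iota>) (r - 2) (seed \<iota> k) = seed \<iota> (k + 1)"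
      using seed_succ[OF True, of \<iota>] unfolding vertex by simp
    with sink_or_source.exchange_relations[OF standard_seed_sink[OF standard_seed_seed
          unmutated_variable_nonzero(1)[OF True]]]
    show ?thesis unfolding vertex by (simp add: k k1)
  next
    case False
    then have "k < 0" by simp
    have "mutate (t_half \<iota>) (r - 2) (seed \<iota> (k + 1)) = seed \<iota> k"
      using seed_pred[OF \<open>k < 0\<close>, of \<iota>] unfolding vertex by simp
    with sink_or_source.exchange_relations[OF standard_seed_source[OF standard_seed_seed
          unmutated_variable_nonzero(2)[OF \<open>k < 0\<close>]]]
    show ?thesis unfolding vertex by (simp add: k k1)
  qed
qed

end

theorem proposition5p1:
  fixes \<iota> :: "quantum_torus \<Rightarrow> 'f::division_ring" and r :: int
  assumes "skew_field_of_fractions \<iota>" and "r \<in> vertices"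
  shows "Q_omega \<iota> (r - 2) * Q_s_omega \<iota> r
           - inverse (t_var \<iota>) * Q_omega \<iota> r * Q_s_omega \<iota> (r - 2) = 1
       \<and> Q_s_omega \<iota> r * Q_omega \<iota> (r - 2)
           - t_var \<iota> * Q_omega \<iota> r * Q_s_omega \<iota> (r - 2) = 1"
proof -
  interpret quantum_torus_fractions \<iota> by standard (rule assms(1))
  from assms(2) obtain l where "r = 2 * l" by (auto simp: vertices_def)
  then have r: "- 2 * (- l) = r" by simp
  have t: "t_half \<iota> powi 2 = t_var \<iota>" "t_half \<iota> powi (- 2) = inverse (t_var \<iota>)"
    by (simp_all add: t_var_def power_int_minus)
  from QQ_relations[of "- l"] show ?thesis
    unfolding r t by (simp add: mult.assoc)
qed

end
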